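(* The total von Neumann (TVN) mean for a set of $m$ Hermitian positive-definite matrices $\{\bm{X}_1,\bm{X}_2,\dots,\bm{X}_m\}$ is given by $$\overline{\bm{X}}_{TVN}=\exp\left(\sum_{j=1}^m\mu_j\times\sum_{i=1}^m\frac{\operatorname{Log}\bm{X}_i}{\mu_i}\right),$$ where $$\mu_i=\sqrt{1+\|\operatorname{Log}\bm{X}_i\|^2},\quad i=1,2,\dots,m.$$
   Context: The matrices are $N\times N$ complex Hermitian positive-definite; $\mathscr{P}(N,\mathbb{C})$ denotes the set of all such matrices, $\operatorname{Log}$ is the principal matrix logarithm, $\exp$ is the matrix exponential, and $\|\bm{X}\|=\sqrt{\operatorname{tr}(\bm{X}^{\mathrm H}\bm{X})}$ is the Frobenius norm, with $\bm{X}^{\mathrm H}$ the conjugate transpose. The TVN divergence on Hermitian positive-definite matrices is $$\delta(\bm{X},\bm{Y})=\frac{\operatorname{tr}\left(\bm{X}(\operatorname{Log}\bm{X}-\operatorname{Log}\bm{Y})-\bm{X}+\bm{Y}\right)}{\sqrt{1+\|\operatorname{Log}\bm{Y}\|^2}},$$ i.e. the total Bregman divergence generated by $F(\bm{X})=\operatorname{tr}(\bm{X}\operatorname{Log}\bm{X}-\bm{X})$. The TVN mean is defined as $$\overline{\bm{X}}:=\underset{\bm{X}\in\mathscr{P}(N,\mathbb{C})}{\operatorname{argmin}}\ \frac1m\sum_{i=1}^m\delta(\bm{X},\bm{X}_i).$$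
   Formalization: The printed factor ∑μ_j is replaced by (∑1/μ_j)^{-1}: for X_1=X_2=A≠I the mean is A, but the printed formula gives A^4. "Is given by" is read as: the corrected formula is the unique minimizer. *)

theory Defs
  imports "HOL-Analysis.Analysis"
begin

definition conj_transpose :: "complex^'n^'m \<Rightarrow> complex^'m^'n" where
  "conj_transpose A = (\<chi> i j. cnj (A $ j $ i))"

definition hermitian :: "complex^'n^'n \<Rightarrow> bool" where
  "hermitian A \<longleftrightarrow> conj_transpose A = A"

definition hpd :: "complex^'n^'n \<Rightarrow> bool" where
  "hpd A \<longleftrightarrow> hermitian A \<and>
     (\<forall>v. v \<noteq> 0 \<longrightarrow> 0 < Re (\<Sum>i\<in>UNIV. cnj (v $ i) * (A *v v) $ i))"

definition eigval :: "complex^'n^'n \<Rightarrow> complex \<Rightarrow> bool" where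
  "eigval A l \<longleftrightarrow> (\<exists>v. v \<noteq> 0 \<and> A *v v = l *s v)"

text \<open>The overloaded \<open>exp\<close> and \<open>^\<close> are not usable here: multiplication on type \<open>vec\<close> is
  componentwise, so the powers are iterates of \<open>\<lambda>B. A ** B\<close>.\<close>

definition mexp :: "complex^'n^'n \<Rightarrow> complex^'n^'n" where
  "mexp A = (\<Sum>k. ((\<lambda>B. A ** B) ^^ k) (mat 1) /\<^sub>R fact k)"

text \<open>The principal logarithm: the unique logarithm all of whose eigenvalues lie in the open
  strip \<open>- pi < Im z < pi\<close>. It exists and is unique for matrices without eigenvalues on the
  closed negative real axis, in particular for positive definite ones; it is unspecified
  elsewhere.\<close>

definition mlog :: "complex^'n^'n \<Rightarrow> complex^'n^'n" where
  "mlog A = (THE L. mexp L = A \<and> (\<forall>l. eigval L l \<longrightarrow> - pi < Im l \<and> Im l < pi))"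

definition frobenius_norm :: "complex^'n^'n \<Rightarrow> real" where
  "frobenius_norm A = sqrt (Re (trace (conj_transpose A ** A)))"

text \<open>Both traces of which the real part is taken (above and below) are real; below this is
  because \<open>X\<close>, \<open>Y\<close> and their logarithms are Hermitian for positive definite \<open>X\<close>, \<open>Y\<close>.\<close>

definition tvn_divergence :: "complex^'n^'n \<Rightarrow> complex^'n^'n \<Rightarrow> real" where
  "tvn_divergence X Y =
     Re (trace (X ** (mlog X - mlog Y) - X + Y)) / sqrt (1 + (frobenius_norm (mlog Y))\<^sup>2)"

definition is_tvn_mean :: "nat \<Rightarrow> (nat \<Rightarrow> complex^'n^'n) \<Rightarrow> complex^'n^'n \<Rightarrow> bool" where
  "is_tvn_mean m Xs M \<longleftrightarrow>
     is_arg_min (\<lambda>X. (1 / real m) * (\<Sum>i=1..m. tvn_divergence X (Xs i))) hpd M"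

end

(* With L the weighted mean of the logarithms, weights 1 / mu i, and W the sum of the weights,
   the objective at X is W / m times the von Neumann divergence of X from exp L, plus a constant:
   tr (X (Log X - Log Y)) is affine in Log Y. By Klein's inequality that divergence is nonnegative
   and vanishes only at X = exp L. In eigenbasis expansions of X and Y, it is the sum over pairs of
   eigenvectors of |<s, t>|^2 (x (ln x - ln y) - x + y), which gives the inequality with its
   equality case.

   The definite description in mlog also requires that a principal logarithm L of a positive
   definite A, not assumed Hermitian, be unique. L commutes with A, so it acts on the eigenspaces of
   A; there every eigenvalue of L is ln a, and a Jordan chain of length two would survive in exp L. *)

theory Submission
  imports Defs "HOL-Computational_Algebra.Fundamental_Theorem_Algebra"
begin

subsection \<open>Orthonormal eigenbases of Hermitian matrices\<close>

text \<open>The Hermitian inner product, antilinear in its first argument. The built-in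
  \<open>\<bullet>\<close> is only its real part and does not detect complex orthogonality.\<close>

definition cip :: "complex^'n \<Rightarrow> complex^'n \<Rightarrow> complex" where
  "cip u v = (\<Sum>i\<in>UNIV. cnj (u $ i) * v $ i)"

lemma cip_add_right: "cip u (v + w) = cip u v + cip u w"
  by (simp add: cip_def distrib_left sum.distrib)

lemma cip_diff_right: "cip u (v - w) = cip u v - cip u w"
  by (simp add: cip_def right_diff_distrib sum_subtractf)

lemma cip_scale_right: "cip u (c *s v) = c * cip u v"
  by (simp add: cip_def sum_distrib_left ac_simps)

lemma cip_scaleR_right: "cip u (r *\<^sub>R v) = of_real r * cip u v"
  by (simp add: cip_def sum_distrib_left scaleR_conv_of_real[where 'a=complex] ac_simps)

lemma cip_zero_right [simp]: "cip u 0 = 0"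
  by (simp add: cip_def)

lemma cip_sum_right: "cip u (sum f S) = (\<Sum>s\<in>S. cip u (f s))"
  by (induction S rule: infinite_finite_induct) (auto simp: cip_add_right)

lemma cnj_cip: "cnj (cip u v) = cip v u"
  by (simp add: cip_def ac_simps)

lemma cip_eq_0_commute: "cip u v = 0 \<longleftrightarrow> cip v u = 0"
  by (metis cnj_cip complex_cnj_zero)

lemma inner_eq_Re_cip: "u \<bullet> v = Re (cip u v)"
  by (simp add: cip_def inner_vec_def inner_complex_def)

lemma cip_self: "cip v v = of_real ((norm v)\<^sup>2)"
proof -
  have "Im (cip v v) = 0"
    by (simp add: cip_def)
  moreover have "Re (cip v v) = (norm v)\<^sup>2"
    by (simp add: power2_norm_eq_inner inner_eq_Re_cip)
  ultimately show ?thesis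
    by (simp add: complex_eq_iff)
qed

lemma hermitian_iff: "hermitian A \<longleftrightarrow> (\<forall>i j. cnj (A $ j $ i) = A $ i $ j)"
  by (simp add: hermitian_def conj_transpose_def vec_eq_iff)

lemma cip_hermitian:
  assumes "hermitian A"
  shows "cip u (A *v v) = cip (A *v u) v"
proof -
  have "cip u (A *v v) = (\<Sum>i\<in>UNIV. \<Sum>j\<in>UNIV. cnj (u $ i) * (A $ i $ j * v $ j))"
    by (simp add: cip_def matrix_vector_mult_def sum_distrib_left)
  also have "\<dots> = (\<Sum>j\<in>UNIV. \<Sum>i\<in>UNIV. cnj (u $ i) * (A $ i $ j * v $ j))"
    by (rule sum.swap)
  also have "\<dots> = (\<Sum>j\<in>UNIV. \<Sum>i\<in>UNIV. cnj (A $ j $ i * u $ i) * v $ j)"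
    using assms by (intro sum.cong refl) (simp add: hermitian_iff)
  also have "\<dots> = cip (A *v u) v"
    by (simp add: cip_def matrix_vector_mult_def sum_distrib_right)
  finally show ?thesis .
qed

definition orthonormal :: "(complex^'n) set \<Rightarrow> bool" where
  "orthonormal S \<longleftrightarrow> (\<forall>s\<in>S. \<forall>t\<in>S. cip s t = (if s = t then 1 else 0))"

text \<open>Complex orthonormality gives real orthogonality, hence real independence. The bound is
  the real dimension, twice the complex one; it serves to find an orthonormal set of greatest
  size.\<close>

lemma orthonormal_bound:
  fixes S :: "(complex^'n) set"
  assumes "orthonormal S"
  shows "finite S \<and> card S \<le> DIM(complex^'n)"
proof (rule independent_bound, rule pairwise_orthogonal_independent)
  show "pairwise orthogonal S"
    using assms by (auto simp: pairwise_def orthogonal_def inner_eq_Re_cip orthonormal_def)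
  show "0 \<notin> S"
    using assms by (force simp: orthonormal_def)
qed

definition onb :: "(complex^'n) set \<Rightarrow> bool" where
  "onb S \<longleftrightarrow> orthonormal S \<and> (\<forall>v. (\<Sum>s\<in>S. cip s v *s s) = v)"

lemma hermitian_eigenvector_in_invariant_subspace:
  fixes A :: "complex^'n^'n"
  assumes A: "hermitian A" and V: "subspace V" and inv: "\<And>v. v \<in> V \<Longrightarrow> A *v v \<in> V"
    and ne: "w \<in> V" "w \<noteq> 0"
  obtains x r where "x \<in> V" "norm x = 1" "A *v x = complex_of_real r *s x"
proof -
  \<comment> \<open>a maximiser of the Rayleigh quotient on \<open>V\<close> is an eigenvector\<close>
  let ?K = "V \<inter> sphere 0 1"
  have lin: "linear ((*v) A)"
    by (auto intro!: linearI simp: matrix_vector_right_distrib matrix_vector_mult_def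
        scaleR_conv_of_real[where 'a=complex] sum_distrib_left vec_eq_iff ac_simps)
  have sym: "u \<bullet> (A *v v) = v \<bullet> (A *v u)" for u v
    by (metis A cip_hermitian inner_commute inner_eq_Re_cip)
  have "compact ?K"
    by (intro closed_Int_compact closed_subspace V compact_sphere)
  moreover have "(inverse (norm w)) *\<^sub>R w \<in> ?K"
    using ne V by (auto intro: subspace_scale)
  moreover have "continuous_on ?K (\<lambda>x. x \<bullet> (A *v x))"
    by (intro continuous_intros linear_continuous_on linear_conv_bounded_linear[THEN iffD1] lin)
  ultimately obtain x where x: "x \<in> ?K" and xmax: "\<And>y. y \<in> ?K \<Longrightarrow> y \<bullet> (A *v y) \<le> x \<bullet> (A *v x)"
    using continuous_attains_sup[of ?K "\<lambda>x. x \<bullet> (A *v x)"] by blast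
  define r where "r = x \<bullet> (A *v x)"
  \<comment> \<open>\<open>g\<close> is the quadratic form of \<open>r - A\<close>: it vanishes at
    \<open>x\<close>, and maximality of \<open>r\<close> makes it nonnegative on
    \<open>V\<close>.\<close>
  define g where "g v = r * (v \<bullet> v) - v \<bullet> (A *v v)" for v
  have gnn: "0 \<le> g v" if "v \<in> V" for v
  proof (cases "v = 0")
    case False
    have "(inverse (norm v)) *\<^sub>R v \<in> ?K"
      using that False V by (auto intro: subspace_scale)
    from xmax[OF this] have "v \<bullet> (A *v v) / (norm v)\<^sup>2 \<le> r"
      by (simp add: linear_cmul[OF lin] r_def power2_eq_square field_simps)
    then show ?thesis
      using False by (simp add: g_def power2_norm_eq_inner field_simps)
  qed (simp add: g_def)
  \<comment> \<open>Half the gradient of \<open>g\<close> at \<open>x\<close>; invariance keeps it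
    in \<open>V\<close>.\<close>
  define h where "h = r *\<^sub>R x - A *v x"
  have h: "h \<in> V"
    using x V inv by (auto simp: h_def intro: subspace_diff subspace_scale)
  have xx: "x \<bullet> x = 1"
    using x by (simp add: norm_eq_1)
  have expand: "g (x + t *\<^sub>R h) = 2 * t * (h \<bullet> h) + t\<^sup>2 * g h" for t
  proof -
    have "h \<bullet> h = r * (x \<bullet> h) - h \<bullet> (A *v x)"
      by (subst (2) h_def) (simp add: inner_diff_right inner_commute)
    moreover have "g (x + t *\<^sub>R h) = 2 * t * (r * (x \<bullet> h) - h \<bullet> (A *v x)) + t\<^sup>2 * g h"
      unfolding g_def
      by (simp add: linear_add[OF lin] linear_cmul[OF lin] inner_add_left inner_add_right xx sym[of x h]
          inner_commute[of h x] r_def[symmetric] power2_eq_square algebra_simps)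
    ultimately show ?thesis
      by simp
  qed
  have "h \<bullet> h = 0"
  proof (rule ccontr)
    assume "h \<bullet> h \<noteq> 0"
    then have c: "h \<bullet> h > 0"
      by simp
    \<comment> \<open>A step against the gradient, short enough for the linear term in
      \<open>expand\<close> to outweigh the quadratic one; the summand 1 keeps the denominator
      positive when \<open>g h = 0\<close>.\<close>
    define t where "t = - (h \<bullet> h) / (1 + g h)"
    have g1: "1 + g h > 0"
      using gnn[OF h] by simp
    have t: "t < 0" using c g1 by (simp add: t_def)
    have "x + t *\<^sub>R h \<in> V"
      using x h V by (auto intro: subspace_add subspace_scale)
    from gnn[OF this] have "0 \<le> t * (2 * (h \<bullet> h) + t * g h)"
      unfolding expand by (simp add: algebra_simps power2_eq_square)
    then have "2 * (h \<bullet> h) + t * g h \<le> 0"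
      using t by (simp add: zero_le_mult_iff)
    moreover have "t * (1 + g h) = - (h \<bullet> h)"
      using g1 by (simp add: t_def)
    ultimately show False
      using t c by (simp add: algebra_simps)
  qed
  then have "A *v x = r *\<^sub>R x"
    by (simp add: h_def)
  then have "A *v x = complex_of_real r *s x"
    by (simp add: vec_eq_iff scaleR_conv_of_real[where 'a=complex])
  with x that show thesis
    by auto
qed

theorem hermitian_eigenbasis:
  fixes A :: "complex^'n^'n"
  assumes A: "hermitian A"
  obtains S d where "onb S" "\<And>s. s \<in> S \<Longrightarrow> A *v s = complex_of_real (d s) *s s"
proof -
  let ?P = "\<lambda>S. orthonormal S \<and> (\<forall>s\<in>S. \<exists>r. A *v s = complex_of_real r *s s)"
  have "?P {}"
    by (simp add: orthonormal_def)
  moreover have "\<forall>S. ?P S \<longrightarrow> card S \<le> DIM(complex^'n)"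
    using orthonormal_bound by blast
  ultimately obtain S where S: "?P S" and Smax: "\<And>T. ?P T \<Longrightarrow> card T \<le> card S"
    using Lattices_Big.ex_has_greatest_nat[of ?P "{}" card "Suc (DIM(complex^'n))"] by (auto simp: less_Suc_eq_le)
  \<comment> \<open>the orthogonal complement of a maximal orthonormal set of eigenvectors is trivial\<close>
  have fin: "finite S"
    using S orthonormal_bound by blast
  from S obtain d where d: "\<And>s. s \<in> S \<Longrightarrow> A *v s = complex_of_real (d s) *s s"
    by metis
  define V where "V = {v. \<forall>s\<in>S. cip s v = 0}"
  have V: "subspace V"
    by (auto simp: subspace_def V_def cip_add_right cip_scaleR_right)
  \<comment> \<open>\<open>A\<close> is self-adjoint and preserves the lines spanned by the members
    of \<open>S\<close>, so it preserves their orthogonal complement.\<close>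
  have inv: "A *v v \<in> V" if "v \<in> V" for v
    unfolding V_def
  proof (intro CollectI ballI)
    fix s assume s: "s \<in> S"
    then have "cip v s = 0"
      using that cip_eq_0_commute by (auto simp: V_def)
    then have "cip v (A *v s) = 0"
      by (simp add: d s cip_scale_right)
    then show "cip s (A *v v) = 0"
      by (metis A cip_hermitian cip_eq_0_commute)
  qed
  have V0: "v = 0" if "v \<in> V" for v
  proof (rule ccontr)
    assume "v \<noteq> 0"
    obtain x r where x: "x \<in> V" "norm x = 1" "A *v x = complex_of_real r *s x"
      using hermitian_eigenvector_in_invariant_subspace[OF A V inv \<open>v \<in> V\<close> \<open>v \<noteq> 0\<close>] by blast
    have xx: "cip x x = 1"
      using x by (simp add: cip_self)
    have "x \<notin> S"
      using x(1) xx by (auto simp: V_def)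
    moreover have "?P (insert x S)"
    proof
      show "orthonormal (insert x S)"
        using S x(1) xx cip_eq_0_commute[of x] unfolding orthonormal_def V_def by fastforce
    qed (use S x in auto)
    then have "card (insert x S) \<le> card S"
      by (rule Smax)
    ultimately show False
      using fin by simp
  qed
  have "(\<Sum>s\<in>S. cip s v *s s) = v" for v
  proof -
    have "v - (\<Sum>s\<in>S. cip s v *s s) \<in> V"
      unfolding V_def
    proof (intro CollectI ballI)
      fix t assume t: "t \<in> S"
      have "cip t (\<Sum>s\<in>S. cip s v *s s) = (\<Sum>s\<in>S. if s = t then cip s v else 0)"
        unfolding cip_sum_right using S t
        by (intro sum.cong refl) (auto simp: cip_scale_right orthonormal_def)
      then show "cip t (v - (\<Sum>s\<in>S. cip s v *s s)) = 0"
        using t fin by (simp add: cip_diff_right)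
    qed
    then show ?thesis
      using V0 by fastforce
  qed
  then have "onb S"
    using S by (simp add: onb_def)
  then show thesis
    using d that by blast
qed

section \<open>Matrices in spectral form\<close>

text \<open>The combination of the rank-one matrices s s^H with coefficients \<open>d s\<close>. For
  an orthonormal basis \<open>S\<close> this is the spectral decomposition, so that matrix functions
  act on \<open>d\<close> alone.\<close>

definition spec :: "(complex^'n) set \<Rightarrow> (complex^'n \<Rightarrow> real) \<Rightarrow> complex^'n^'n" where
  "spec S d = (\<chi> i j. \<Sum>s\<in>S. complex_of_real (d s) * (s $ i * cnj (s $ j)))"

lemma spec_mult_vec: "spec S d *v v = (\<Sum>s\<in>S. (complex_of_real (d s) * cip s v) *s s)"
proof -
  have "(spec S d *v v) $ i = (\<Sum>s\<in>S. (complex_of_real (d s) * cip s v) *s s) $ i" for i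
  proof -
    have "(spec S d *v v) $ i
        = (\<Sum>j\<in>UNIV. \<Sum>s\<in>S. complex_of_real (d s) * (s $ i * cnj (s $ j)) * v $ j)"
      by (simp add: spec_def matrix_vector_mult_def sum_distrib_right)
    also have "\<dots> = (\<Sum>s\<in>S. \<Sum>j\<in>UNIV. complex_of_real (d s) * (s $ i * cnj (s $ j)) * v $ j)"
      by (rule sum.swap)
    also have "\<dots> = (\<Sum>s\<in>S. (complex_of_real (d s) * cip s v) *s s) $ i"
      by (simp add: cip_def sum_distrib_left sum_distrib_right ac_simps)
    finally show ?thesis .
  qed
  then show ?thesis
    by (simp add: vec_eq_iff)
qed

lemma finite_onb: "onb S \<Longrightarrow> finite S"
  by (simp add: onb_def orthonormal_bound)

lemma cip_onb: "onb S \<Longrightarrow> s \<in> S \<Longrightarrow> t \<in> S \<Longrightarrow> cip s t = (if s = t then 1 else 0)"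
  by (simp add: onb_def orthonormal_def)

lemma onb_nonzero: "onb S \<Longrightarrow> s \<in> S \<Longrightarrow> s \<noteq> 0"
  using cip_onb[of S s s] by auto

lemma spec_mult_basis:
  assumes "onb S" "t \<in> S"
  shows "spec S d *v t = complex_of_real (d t) *s t"
proof -
  have "spec S d *v t = (\<Sum>s\<in>S. if s = t then complex_of_real (d s) *s s else 0)"
    unfolding spec_mult_vec using assms by (intro sum.cong refl) (auto simp: cip_onb)
  then show ?thesis
    using assms by (simp add: finite_onb)
qed

text \<open>Complex linearity and the basis expansion of a vector. It reduces matrix identities to
  computations with eigenvalues.\<close>

lemma matrix_eqI_onb:
  assumes S: "onb S" and eq: "\<And>s. s \<in> S \<Longrightarrow> A *v s = B *v s"
  shows "A = B"
proof -
  have "A *v v = B *v v" for v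
  proof -
    have "C *v v = (\<Sum>s\<in>S. cip s v *s (C *v s))" for C
      using S vec.linear_sum[OF matrix_vector_mul_linear_gen, of C "\<lambda>s. cip s v *s s" S]
      by (simp add: onb_def vector_scalar_commute)
    then show ?thesis
      using eq by (metis (no_types, lifting) sum.cong)
  qed
  then show ?thesis
    by (simp add: matrix_eq)
qed

lemma hermitian_spec: "hermitian (spec S d)"
  by (simp add: hermitian_iff spec_def mult_ac)

lemma hermitian_imp_spec:
  assumes "hermitian A"
  obtains S d where "onb S" "A = spec S d"
  using assms by (metis hermitian_eigenbasis matrix_eqI_onb spec_mult_basis)

lemma hpd_iff: "hpd A \<longleftrightarrow> hermitian A \<and> (\<forall>v. v \<noteq> 0 \<longrightarrow> 0 < Re (cip v (A *v v)))"
  by (simp add: hpd_def cip_def)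

text \<open>The quadratic form at \<open>v\<close> is the sum of \<open>d s\<close> times |<s,
  v>|^2, and some <s, v> is nonzero when \<open>v\<close> is.\<close>

lemma hpd_spec_iff:
  assumes S: "onb S"
  shows "hpd (spec S d) \<longleftrightarrow> (\<forall>s\<in>S. 0 < d s)"
proof
  assume L: "hpd (spec S d)"
  show "\<forall>s\<in>S. 0 < d s"
  proof
    fix s assume s: "s \<in> S"
    then have "0 < Re (cip s (spec S d *v s))"
      using L onb_nonzero[OF S s] by (simp add: hpd_iff)
    then show "0 < d s"
      using S s by (simp add: spec_mult_basis cip_scale_right cip_onb)
  qed
next
  assume pos: "\<forall>s\<in>S. 0 < d s"
  have "0 < Re (cip v (spec S d *v v))" if "v \<noteq> 0" for v
  proof -
    have "cip v (spec S d *v v) = (\<Sum>s\<in>S. complex_of_real (d s * (cmod (cip s v))\<^sup>2))"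
      unfolding spec_mult_vec cip_sum_right
      by (intro sum.cong refl)
        (simp add: cip_scale_right mult.assoc complex_norm_square cnj_cip del: of_real_power)
    then have "Re (cip v (spec S d *v v)) = (\<Sum>s\<in>S. d s * (cmod (cip s v))\<^sup>2)"
      by simp
    moreover have "\<exists>s\<in>S. cip s v \<noteq> 0"
    proof (rule ccontr)
      assume "\<not> ?thesis"
      then have "(\<Sum>s\<in>S. cip s v *s s) = 0"
        by simp
      then show False
        using S that by (simp add: onb_def)
    qed
    then have "0 < (\<Sum>s\<in>S. d s * (cmod (cip s v))\<^sup>2)"
      using pos finite_onb[OF S] by (force intro: sum_pos2 simp: less_imp_le)
    ultimately show ?thesis
      by simp
  qed
  then show "hpd (spec S d)"
    by (simp add: hpd_iff hermitian_spec)
qed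

subsection \<open>Matrix exponential and principal logarithm\<close>

lemma bounded_linear_matrix_mult_right: "bounded_linear (\<lambda>B :: complex^'n^'n. A ** B)"
  by (rule linear_conv_bounded_linear[THEN iffD1], rule linearI)
    (simp_all add: matrix_matrix_mult_def vec_eq_iff distrib_left sum.distrib scaleR_sum_right)

lemma bounded_linear_matrix_vector_left: "bounded_linear (\<lambda>A :: complex^'n^'n. A *v v)"
  by (rule linear_conv_bounded_linear[THEN iffD1], rule linearI)
    (simp_all add: matrix_vector_mult_def vec_eq_iff distrib_right sum.distrib scaleR_sum_right)

lemma bounded_linear_matrix_vector_right: "bounded_linear (\<lambda>v :: complex^'n. A *v v)"
  by (rule linear_conv_bounded_linear[THEN iffD1], rule linearI)
    (simp_all add: matrix_vector_mult_def vec_eq_iff distrib_left sum.distrib scaleR_sum_right)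

lemma bounded_linear_scalar_left: "bounded_linear (\<lambda>c. c *s (v :: complex^'n))"
  by (rule linear_conv_bounded_linear[THEN iffD1], rule linearI) (simp_all add: vec_eq_iff distrib_right)

text \<open>Left multiplication by \<open>A\<close> is bounded by some \<open>K\<close>, so the
  exponential series of \<open>K\<close> dominates.\<close>

lemma summable_mexp: "summable (\<lambda>k. ((\<lambda>B. A ** B) ^^ k) (mat 1) /\<^sub>R fact k)"
  for A :: "complex^'n^'n"
proof -
  have "bounded_linear (\<lambda>B :: complex^'n^'n. A ** B)"
    by (rule bounded_linear_matrix_mult_right)
  from bounded_linear.pos_bounded[OF this]
  obtain K where K: "0 < K" "\<And>B :: complex^'n^'n. norm (A ** B) \<le> norm B * K"
    by auto
  have bound: "norm (((\<lambda>B. A ** B) ^^ k) (mat 1)) \<le> K ^ k * norm (mat 1 :: complex^'n^'n)" for k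
  proof (induction k)
    case (Suc k)
    then have "norm (((\<lambda>B. A ** B) ^^ k) (mat 1)) * K \<le> K ^ k * norm (mat 1 :: complex^'n^'n) * K"
      using K(1) by (simp add: mult_right_mono)
    with K(2) show ?case
      by (force intro: order_trans simp: mult_ac)
  qed simp
  have "summable (\<lambda>k. inverse (fact k) * K ^ k * norm (mat 1 :: complex^'n^'n))"
    by (rule summable_mult2) (rule summable_exp)
  then show ?thesis
    by (rule summable_comparison_test') (use bound in \<open>simp add: mult.assoc\<close>)
qed

text \<open>Evaluation at \<open>v\<close> is bounded linear and passes through the series. All
  later facts on \<open>mexp\<close> rest on this vector series.\<close>

lemma mexp_vec_sums: "(\<lambda>k. (((*v) A) ^^ k) v /\<^sub>R fact k) sums (mexp A *v v)"
  for A :: "complex^'n^'n"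
proof -
  have pow: "((\<lambda>B. A ** B) ^^ k) (mat 1) *v v = (((*v) A) ^^ k) v" for k
    by (induction k) (simp_all flip: matrix_vector_mul_assoc)
  have bl: "bounded_linear (\<lambda>A :: complex^'n^'n. A *v v)"
    by (rule bounded_linear_matrix_vector_left)
  show ?thesis
    using bounded_linear.sums[OF bl summable_sums[OF summable_mexp[of A]]]
    by (simp add: mexp_def linear_cmul[OF bounded_linear.linear[OF bounded_linear_matrix_vector_left]] pow)
qed

text \<open>Applying \<open>A\<close> termwise turns the series at \<open>v\<close> into the series
  at \<open>A *v v\<close>. Hence \<open>A\<close> preserves the eigenspaces of
  \<open>mexp A\<close>.\<close>

lemma mexp_commute: "A *v (mexp A *v v) = mexp A *v (A *v v)"
proof -
  have "bounded_linear ((*v) A)"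
    by (rule bounded_linear_matrix_vector_right)
  from bounded_linear.sums[OF this mexp_vec_sums[of A v]]
  have "(\<lambda>k. (((*v) A) ^^ k) (A *v v) /\<^sub>R fact k) sums (A *v (mexp A *v v))"
    by (simp add: linear_cmul[OF bounded_linear.linear[OF bounded_linear_matrix_vector_right]] funpow_swap1)
  then show ?thesis
    using mexp_vec_sums sums_unique2 by blast
qed

text \<open>On a Jordan chain of length two (or, with \<open>w = 0\<close>, an eigenvector) the
  iterates are explicit, and the coefficients of \<open>u\<close> and of \<open>w\<close> both sum
  to \<open>exp l\<close>.\<close>

lemma mexp_jordan_chain:
  assumes "A *v u = l *s u + w" "A *v w = l *s w"
  shows "mexp A *v u = exp l *s (u + w)"
proof -
  \<comment> \<open>At \<open>k = 0\<close> the truncated \<open>k - 1\<close> is harmless, its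
    factor \<open>of_nat k\<close> being 0.\<close>
  have pow: "(((*v) A) ^^ k) u = l ^ k *s u + (of_nat k * l ^ (k - 1)) *s w" for k
  proof (induction k)
    case (Suc k)
    show ?case
      unfolding funpow.simps o_apply Suc
      by (cases k) (simp_all add: assms vec.add vec.scale matrix_vector_right_distrib vector_scalar_commute
          vector_add_ldistrib vector_smult_assoc vec_eq_iff algebra_simps)
  qed simp
  have bl: "bounded_linear (\<lambda>c. c *s v)" for v :: "complex^'a"
    by (rule bounded_linear_scalar_left)
  \<comment> \<open>The coefficient series of \<open>w\<close> is the exponential series shifted by
    one place; its term at 0 vanishes.\<close>
  have "(\<lambda>k. (of_nat (Suc k) * l ^ (Suc k - 1)) /\<^sub>R fact (Suc k)) sums exp l"
    using exp_converges[of l] by (simp add: scaleR_conv_of_real field_simps del: of_nat_Suc)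
  then have d: "(\<lambda>k. (of_nat k * l ^ (k - 1)) /\<^sub>R fact k) sums exp l"
    by (subst (asm) sums_Suc_iff) simp
  have "(\<lambda>k. (l ^ k /\<^sub>R fact k) *s u + ((of_nat k * l ^ (k - 1)) /\<^sub>R fact k) *s w)
      sums (exp l *s u + exp l *s w)"
    by (intro sums_add bounded_linear.sums[OF bl] exp_converges d)
  moreover have "(l ^ k /\<^sub>R fact k) *s u + ((of_nat k * l ^ (k - 1)) /\<^sub>R fact k) *s w
      = (((*v) A) ^^ k) u /\<^sub>R fact k" for k
    by (simp add: pow vec_eq_iff algebra_simps)
  ultimately show ?thesis
    using mexp_vec_sums[of A u] by (simp add: vector_add_ldistrib sums_iff)
qed

lemma mexp_eigenvector:
  assumes "A *v v = l *s v"
  shows "mexp A *v v = exp l *s v"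
  using mexp_jordan_chain[of A v l 0] assms by simp

lemma mexp_spec:
  assumes "onb S"
  shows "mexp (spec S d) = spec S (\<lambda>s. exp (d s))"
  using assms
  by (intro matrix_eqI_onb[OF assms]) (simp add: spec_mult_basis mexp_eigenvector[OF spec_mult_basis] exp_of_real)

section \<open>Uniqueness of the principal logarithm\<close>

text \<open>The vector p(A) v, computed by Horner's scheme without forming the matrix p(A).\<close>

definition poly_act :: "complex^'n^'n \<Rightarrow> complex^'n \<Rightarrow> complex poly \<Rightarrow> complex^'n" where
  "poly_act A v p = fold_coeffs (\<lambda>c w. c *s v + A *v w) p 0"

lemma poly_act_0 [simp]: "poly_act A v 0 = 0"
  by (simp add: poly_act_def)

lemma poly_act_pCons [simp]: "poly_act A v (pCons c p) = c *s v + A *v poly_act A v p"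
  by (cases "c = 0 \<and> p = 0") (auto simp: poly_act_def)

lemma poly_act_add: "poly_act A v (p + q) = poly_act A v p + poly_act A v q"
  by (induction p q rule: poly_induct2)
    (simp_all add: vector_sadd_rdistrib matrix_vector_right_distrib)

lemma poly_act_smult: "poly_act A v (smult c p) = c *s poly_act A v p"
  by (induction p) (simp_all add: vector_add_ldistrib vector_scalar_commute)

lemma poly_act_monom: "poly_act A v (monom c i) = c *s (((*v) A) ^^ i) v"
  by (induction i) (simp_all add: monom_0 monom_Suc vector_scalar_commute)

lemma poly_act_sum: "poly_act A v (sum f I) = (\<Sum>i\<in>I. poly_act A v (f i))"
  by (induction I rule: infinite_finite_induct) (simp_all add: poly_act_add)

lemma poly_act_linear_factor:
  "poly_act A v ([:- z, 1:] * p) = A *v poly_act A v p - z *s poly_act A v p"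
proof -
  have "[:- z, 1:] * p = smult (- z) p + pCons 0 p"
    by simp
  then show ?thesis
    by (simp only: poly_act_add poly_act_smult poly_act_pCons) simp
qed

text \<open>\<open>A - z\<close> commutes with p(A), so the factor may act first, on the
  vector.\<close>

lemma poly_act_linear_factor': "poly_act A v ([:- z, 1:] * p) = poly_act A (A *v v - z *s v) p"
proof -
  have "poly_act A (A *v v - z *s v) p = A *v poly_act A v p - z *s poly_act A v p"
    by (induction p) (simp_all add: matrix_vector_right_distrib vector_scalar_commute
        matrix_vector_mult_diff_distrib vector_add_ldistrib vec.scale_right_diff_distrib
        vector_smult_assoc mult.commute)
  then show ?thesis
    by (simp only: poly_act_linear_factor)
qed

text \<open>The iterates of \<open>v\<close> with exponents up to the real dimension are one too
  many to be independent; a real relation among them is the polynomial.\<close>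

lemma annihilating_poly_exists:
  fixes A :: "complex^'n^'n"
  obtains p where "p \<noteq> 0" "poly_act A v p = 0"
proof -
  let ?I = "{..DIM(complex^'n)}"
  define u where "u i = (((*v) A) ^^ i) v" for i
  show thesis
  proof (cases "inj_on u ?I")
    \<comment> \<open>Dependence concerns the set of iterates, so a repeated iterate is treated
      apart, with the difference of two monomials.\<close>
    case False
    then obtain i j where ij: "i \<noteq> j" "u i = u j"
      by (auto simp: inj_on_def)
    let ?p = "monom 1 i + monom (-1) j :: complex poly"
    have "poly_act A v ?p = 0"
      using ij by (simp add: poly_act_add poly_act_monom u_def vec_eq_iff)
    moreover have "coeff ?p i \<noteq> 0"
      using ij by simp
    ultimately show thesis
      using that by (metis coeff_0)
  next
    case True
    then have "card (u ` ?I) > DIM(complex^'n)"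
      by (simp add: card_image)
    then have "dependent (u ` ?I)"
      by (intro dependent_biggerset) auto
    then obtain c where c: "\<exists>w\<in>u ` ?I. c w \<noteq> 0" "(\<Sum>w\<in>u ` ?I. c w *\<^sub>R w) = 0"
      by (auto simp: dependent_finite)
    let ?p = "\<Sum>i\<in>?I. monom (complex_of_real (c (u i))) i"
    have "poly_act A v ?p = (\<Sum>i\<in>?I. c (u i) *\<^sub>R u i)"
      by (simp add: poly_act_sum poly_act_monom u_def vec_eq_iff scaleR_conv_of_real[where 'a=complex])
    also have "\<dots> = 0"
      using c(2) True by (simp add: sum.reindex)
    finally have "poly_act A v ?p = 0" .
    moreover from c(1) obtain i where "i \<in> ?I" "c (u i) \<noteq> 0"
      by blast
    then have "coeff ?p i \<noteq> 0"
      by (simp add: coeff_sum)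
    ultimately show thesis
      using that by (metis coeff_0)
  qed
qed

text \<open>Induction on the degree of a polynomial annihilating the vector, splitting off one
  linear factor at a time, takes the place of a Jordan decomposition of \<open>L\<close> on the
  eigenspace \<open>E\<close>.\<close>

lemma principal_log_eigenvector:
  fixes L :: "complex^'n^'n"
  assumes strip: "\<And>l. eigval L l \<Longrightarrow> - pi < Im l \<and> Im l < pi"
    and a: "0 < a" and v: "mexp L *v v = complex_of_real a *s v"
  shows "L *v v = complex_of_real (ln a) *s v"
proof -
  define E where "E = {v. mexp L *v v = complex_of_real a *s v}"
  let ?r = "complex_of_real (ln a)"
  have expr: "exp ?r = complex_of_real a"
    using a by (simp add: exp_of_real)
  have E_diff: "x - y \<in> E" if "x \<in> E" "y \<in> E" for x y
    using that by (simp add: E_def matrix_vector_mult_diff_distrib vec_eq_iff algebra_simps)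
  have E_add: "x + y \<in> E" if "x \<in> E" "y \<in> E" for x y
    using that by (simp add: E_def matrix_vector_right_distrib vec_eq_iff algebra_simps)
  have E_scale: "c *s x \<in> E" if "x \<in> E" for c x
    using that by (simp add: E_def vector_scalar_commute vec_eq_iff)
  have E_L: "L *v x \<in> E" if "x \<in> E" for x
    using that by (simp add: E_def vector_scalar_commute flip: mexp_commute)
  have E_poly: "poly_act L x p \<in> E" if "x \<in> E" for x p
    by (induction p) (use that E_add E_scale E_L in \<open>auto simp: E_def\<close>)
  \<comment> \<open>The strip enters here: on it \<open>Ln\<close> inverts \<open>exp\<close>, so
    \<open>exp l = a\<close> leaves only \<open>ln a\<close>.\<close>
  have eig: "l = ?r" if "x \<in> E" "x \<noteq> 0" "L *v x = l *s x" for x l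
  proof -
    have "exp l *s x = complex_of_real a *s x"
      using that mexp_eigenvector[of L x l] by (simp add: E_def)
    then have "exp l = complex_of_real a"
      using \<open>x \<noteq> 0\<close> by (simp only: vec.scale_cancel_right) simp
    moreover have "- pi < Im l" "Im l < pi"
      using strip[of l] that by (auto simp: eigval_def)
    ultimately show ?thesis
      using a by (metis Ln_exp Ln_of_real less_imp_le)
  qed
  \<comment> \<open>With w = L x - r x the chain formula gives a (x + w) = a x, so w = 0.\<close>
  have no_chain: "L *v x - ?r *s x = 0"
    if "x \<in> E" "L *v (L *v x - ?r *s x) = ?r *s (L *v x - ?r *s x)" for x
  proof -
    have "exp ?r *s (x + (L *v x - ?r *s x)) = complex_of_real a *s x"
      using mexp_jordan_chain[of L x ?r "L *v x - ?r *s x"] that by (simp add: E_def)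
    then show ?thesis
      using a by (simp add: expr vec_eq_iff)
  qed
  have "L *v x = ?r *s x" if "p \<noteq> 0" "poly_act L x p = 0" "x \<in> E" for p x
    using that
  proof (induction "degree p" arbitrary: p x)
    case 0
    then obtain c where "p = [:c:]" "c \<noteq> 0"
      by (metis degree_eq_zeroE pCons_0_0)
    with 0 have "x = 0"
      by simp
    then show ?case
      by simp
  next
    case (Suc n)
    have "\<not> constant (poly p)"
      using Suc.hyps(2) by (simp add: constant_degree)
    then obtain z where "poly p z = 0"
      using fundamental_theorem_of_algebra by blast
    then obtain q where q: "p = [:- z, 1:] * q"
      by (auto simp: poly_eq_0_iff_dvd)
    have "q \<noteq> 0"
      using Suc.prems(1) q by auto
    moreover have "n = degree q"
      using Suc.hyps(2) \<open>q \<noteq> 0\<close> by (simp add: q degree_mult_eq del: mult_pCons_left)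
    ultimately have IH: "poly_act L y q = 0 \<Longrightarrow> y \<in> E \<Longrightarrow> L *v y = ?r *s y" for y
      using Suc.hyps(1) by blast
    show ?case
    proof (cases "z = ?r")
      case True
      \<comment> \<open>The factor acts first: \<open>q\<close> annihilates L x - r x, which by
        induction is an eigenvector or 0, and \<open>no_chain\<close> applies.\<close>
      have "L *v x - ?r *s x \<in> E"
        using Suc.prems(3) E_diff E_L E_scale by blast
      then have "L *v (L *v x - ?r *s x) = ?r *s (L *v x - ?r *s x)"
        using IH Suc.prems(2) unfolding q poly_act_linear_factor' True by blast
      then show ?thesis
        using no_chain Suc.prems(3) by simp
    next
      case False
      \<comment> \<open>The factor acts last: if nonzero, q(L) x would be an eigenvector in
        \<open>E\<close> for \<open>z\<close>, against \<open>eig\<close>. So \<open>q\<close>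
        already annihilates \<open>x\<close>.\<close>
      have "L *v poly_act L x q = z *s poly_act L x q"
        using Suc.prems(2) unfolding q poly_act_linear_factor by simp
      then have "poly_act L x q = 0"
        using eig E_poly Suc.prems(3) False by blast
      then show ?thesis
        using IH Suc.prems(3) by blast
    qed
  qed
  moreover obtain p where "p \<noteq> 0" "poly_act L v p = 0"
    by (rule annihilating_poly_exists)
  moreover have "v \<in> E"
    using v by (simp add: E_def)
  ultimately show ?thesis
    by metis
qed

lemma hermitian_eigval_real:
  assumes "hermitian A" "eigval A l"
  shows "Im l = 0"
proof -
  obtain v where v: "v \<noteq> 0" "A *v v = l *s v"
    using assms by (auto simp: eigval_def)
  have "cnj (cip v (A *v v)) = cip v (A *v v)"
    using cip_hermitian[OF assms(1)] by (simp add: cnj_cip)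
  then have "cnj l = l"
    using v by (simp add: cip_scale_right cip_self)
  then show ?thesis
    by (metis Reals_cnj_iff complex_is_Real_iff)
qed

text \<open>The candidate is Hermitian, so its eigenvalues are real and lie in the strip; any other
  principal logarithm agrees with it on the basis by
  \<open>principal_log_eigenvector\<close>.\<close>

lemma mlog_spec:
  assumes S: "onb S" and d: "\<And>s. s \<in> S \<Longrightarrow> 0 < d s"
  shows "mlog (spec S d) = spec S (\<lambda>s. ln (d s))"
  unfolding mlog_def
proof (rule the_equality, intro conjI allI impI)
  show mexp: "mexp (spec S (\<lambda>s. ln (d s))) = spec S d"
    by (rule matrix_eqI_onb[OF S]) (simp add: mexp_spec spec_mult_basis S d)
  show "- pi < Im l" "Im l < pi" if "eigval (spec S (\<lambda>s. ln (d s))) l" for l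
    using that hermitian_eigval_real hermitian_spec by fastforce+
next
  fix L :: "complex^'a^'a"
  assume L: "mexp L = spec S d \<and> (\<forall>l. eigval L l \<longrightarrow> - pi < Im l \<and> Im l < pi)"
  show "L = spec S (\<lambda>s. ln (d s))"
  proof (rule matrix_eqI_onb[OF S])
    fix s assume s: "s \<in> S"
    have "L *v s = complex_of_real (ln (d s)) *s s"
      by (rule principal_log_eigenvector) (use L S s d in \<open>simp_all add: spec_mult_basis\<close>)
    then show "L *v s = spec S (\<lambda>s. ln (d s)) *v s"
      using S s by (simp add: spec_mult_basis)
  qed
qed

subsection \<open>Klein's inequality\<close>

lemma trace_mult_spec: "trace (A ** spec S d) = (\<Sum>s\<in>S. complex_of_real (d s) * cip s (A *v s))"
proof -
  have "trace (A ** spec S d)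
      = (\<Sum>i\<in>UNIV. \<Sum>j\<in>UNIV. \<Sum>s\<in>S. complex_of_real (d s) * (cnj (s $ i) * (A $ i $ j * s $ j)))"
    by (simp add: trace_def matrix_matrix_mult_def spec_def sum_distrib_left mult_ac)
  also have "\<dots> = (\<Sum>i\<in>UNIV. \<Sum>s\<in>S. \<Sum>j\<in>UNIV. complex_of_real (d s) * (cnj (s $ i) * (A $ i $ j * s $ j)))"
    by (intro sum.cong refl sum.swap)
  also have "\<dots> = (\<Sum>s\<in>S. \<Sum>i\<in>UNIV. \<Sum>j\<in>UNIV. complex_of_real (d s) * (cnj (s $ i) * (A $ i $ j * s $ j)))"
    by (rule sum.swap)
  also have "\<dots> = (\<Sum>s\<in>S. complex_of_real (d s) * cip s (A *v s))"
    by (simp add: cip_def matrix_vector_mult_def sum_distrib_left)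
  finally show ?thesis .
qed

lemma Re_trace_spec_mult_spec:
  "Re (trace (spec S a ** spec T b)) = (\<Sum>t\<in>T. \<Sum>s\<in>S. (cmod (cip s t))\<^sup>2 * (a s * b t))"
proof -
  have "cip t (spec S a *v t) = complex_of_real (\<Sum>s\<in>S. a s * (cmod (cip s t))\<^sup>2)" for t
    unfolding spec_mult_vec cip_sum_right of_real_sum
    by (intro sum.cong refl)
      (simp add: cip_scale_right mult.assoc complex_norm_square cnj_cip del: of_real_power)
  then have "trace (spec S a ** spec T b)
      = complex_of_real (\<Sum>t\<in>T. \<Sum>s\<in>S. (cmod (cip s t))\<^sup>2 * (a s * b t))"
    by (simp add: trace_mult_spec sum_distrib_left mult_ac)
  then show ?thesis
    by simp
qed

lemma spec_one:
  assumes "onb S"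
  shows "spec S (\<lambda>_. 1) = mat 1"
  by (rule matrix_eqI_onb[OF assms]) (simp add: spec_mult_basis assms)

lemma spec_mult_spec:
  assumes "onb S"
  shows "spec S a ** spec S b = spec S (\<lambda>s. a s * b s)"
  by (rule matrix_eqI_onb[OF assms])
    (simp add: spec_mult_basis assms vector_scalar_commute mult.commute flip: matrix_vector_mul_assoc)

text \<open>With u = y / x the expression is x (u - 1 - ln u), and ln u \<le> u - 1 with equality
  only at u = 1.\<close>

lemma relative_entropy_pos:
  fixes x y :: real
  assumes "0 < x" "0 < y"
  shows "0 \<le> x * (ln x - ln y) - x + y" "x * (ln x - ln y) - x + y = 0 \<Longrightarrow> x = y"
proof -
  have eq: "x * (ln x - ln y) - x + y = x * ((y / x - 1) - ln (y / x))"
    using assms by (simp add: ln_div field_simps)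
  show "0 \<le> x * (ln x - ln y) - x + y"
    unfolding eq using assms ln_le_minus_one[of "y / x"] by simp
  assume "x * (ln x - ln y) - x + y = 0"
  then have "ln (y / x) = y / x - 1"
    using assms unfolding eq by simp
  then have "y / x = 1"
    using assms by (intro ln_eq_minus_one) simp_all
  then show "x = y"
    using assms by simp
qed

lemma matrix_diff_distrib_left: "(A :: complex^'n^'m) ** (B - C) = A ** B - A ** C"
  by (simp add: matrix_matrix_mult_def vec_eq_iff right_diff_distrib sum_subtractf)

theorem klein_inequality:
  fixes X Y :: "complex^'n^'n"
  assumes "hpd X" "hpd Y"
  defines "D \<equiv> Re (trace (X ** (mlog X - mlog Y) - X + Y))"
  shows "0 \<le> D" "D = 0 \<longleftrightarrow> X = Y"
proof -
  obtain S x where S: "onb S" and X: "X = spec S x"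
    using assms(1) hermitian_imp_spec by (metis hpd_iff)
  obtain T y where T: "onb T" and Y: "Y = spec T y"
    using assms(2) hermitian_imp_spec by (metis hpd_iff)
  have x: "0 < x s" if "s \<in> S" for s
    using assms(1) that by (simp add: X S hpd_spec_iff)
  have y: "0 < y t" if "t \<in> T" for t
    using assms(2) that by (simp add: Y T hpd_spec_iff)
  define k where "k s t = x s * (ln (x s) - ln (y t)) - x s + y t" for s t
  have k: "0 \<le> k s t" "k s t = 0 \<Longrightarrow> x s = y t" if "s \<in> S" "t \<in> T" for s t
    using relative_entropy_pos[of "x s" "y t"] x y that by (simp_all add: k_def)
  define q where "q s t = (cmod (cip s t))\<^sup>2" for s t :: "complex^'n"
  \<comment> \<open>Inserting the identity as a spectral matrix over the other basis gives all four
    traces the same weights \<open>q s t\<close>.\<close>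
  have "Re (trace (X ** mlog X)) = (\<Sum>t\<in>T. \<Sum>s\<in>S. q s t * (x s * ln (x s)))"
    using Re_trace_spec_mult_spec[of S "\<lambda>s. x s * ln (x s)" T "\<lambda>_. 1"]
    by (simp add: X S T x mlog_spec spec_mult_spec spec_one q_def)
  moreover have "Re (trace (X ** mlog Y)) = (\<Sum>t\<in>T. \<Sum>s\<in>S. q s t * (x s * ln (y t)))"
    by (simp add: X Y T y mlog_spec Re_trace_spec_mult_spec q_def)
  moreover have "Re (trace X) = (\<Sum>t\<in>T. \<Sum>s\<in>S. q s t * x s)"
    using Re_trace_spec_mult_spec[of S x T "\<lambda>_. 1"] by (simp add: X T spec_one q_def)
  moreover have "Re (trace Y) = (\<Sum>t\<in>T. \<Sum>s\<in>S. q s t * y t)"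
    using Re_trace_spec_mult_spec[of S "\<lambda>_. 1" T y] by (simp add: Y S spec_one q_def)
  moreover have "D = Re (trace (X ** mlog X)) - Re (trace (X ** mlog Y)) - Re (trace X) + Re (trace Y)"
    by (simp add: D_def matrix_diff_distrib_left trace_add trace_sub)
  ultimately have D: "D = (\<Sum>t\<in>T. \<Sum>s\<in>S. q s t * k s t)"
    by (simp add: k_def algebra_simps flip: sum.distrib sum_subtractf)
  show "0 \<le> D"
    unfolding D using k by (intro sum_nonneg mult_nonneg_nonneg) (simp_all add: q_def)
  show "D = 0 \<longleftrightarrow> X = Y"
  proof
    assume "D = 0"
    then have zero: "q s t * k s t = 0" if "s \<in> S" "t \<in> T" for s t
      using that k finite_onb[OF S] finite_onb[OF T] unfolding D
      by (simp add: sum_nonneg_eq_0_iff sum_nonneg q_def)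
    show "X = Y"
    proof (rule matrix_eqI_onb[OF T])
      fix t assume t: "t \<in> T"
      \<comment> \<open>Wherever the overlap of \<open>s\<close> and \<open>t\<close> is nonzero,
        the eigenvalues agree, so \<open>y t\<close> may replace \<open>x s\<close> in the expansion
        of X t.\<close>
      have "X *v t = (\<Sum>s\<in>S. complex_of_real (y t) *s (cip s t *s s))"
        unfolding X spec_mult_vec
      proof (intro sum.cong refl)
        fix s assume "s \<in> S"
        with zero t k(2) have "cip s t = 0 \<or> x s = y t"
          by (fastforce simp: q_def)
        then show "(complex_of_real (x s) * cip s t) *s s
            = complex_of_real (y t) *s (cip s t *s s)"
          by auto
      qed
      also have "\<dots> = complex_of_real (y t) *s t"
        using S by (simp only: onb_def flip: vec.scale_sum_right)
      finally show "X *v t = Y *v t"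
        by (simp add: Y spec_mult_basis T t)
    qed
  qed (simp add: D_def trace_def)
qed

section \<open>Minimising the averaged divergence\<close>

lemma hermitian_mlog:
  assumes "hpd A"
  shows "hermitian (mlog A)"
proof -
  obtain S d where S: "onb S" and A: "A = spec S d"
    using assms hermitian_imp_spec by (metis hpd_iff)
  then show ?thesis
    using assms by (simp add: hpd_spec_iff mlog_spec hermitian_spec)
qed

lemma
  assumes "hermitian A"
  shows hpd_mexp: "hpd (mexp A)" and mlog_mexp: "mlog (mexp A) = A"
proof -
  obtain S d where S: "onb S" and A: "A = spec S d"
    using assms hermitian_imp_spec by metis
  show "hpd (mexp A)" "mlog (mexp A) = A"
    by (simp_all add: A S mexp_spec hpd_spec_iff mlog_spec)
qed

lemma hermitian_scaleR: "hermitian A \<Longrightarrow> hermitian (r *\<^sub>R A)"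
  by (simp add: hermitian_iff)

lemma hermitian_sum: "(\<And>i. i \<in> I \<Longrightarrow> hermitian (f i)) \<Longrightarrow> hermitian (sum f I)"
  by (simp add: hermitian_iff)

text \<open>The order-theoretic end of the argument, free of matrices: compare with the value at
  \<open>y\<close>, where \<open>g\<close> vanishes.\<close>

lemma is_arg_min_shift:
  fixes f g :: "'a \<Rightarrow> real"
  assumes f: "\<And>x. P x \<Longrightarrow> f x = c * g x + e" and c: "0 < c"
    and P: "P y" and nonneg: "\<And>x. P x \<Longrightarrow> 0 \<le> g x" and zero: "\<And>x. P x \<Longrightarrow> g x = 0 \<longleftrightarrow> x = y"
  shows "is_arg_min f P x \<longleftrightarrow> x = y"
proof
  assume x: "is_arg_min f P x"
  then have "P x" "\<not> f y < f x"
    using P by (auto simp: is_arg_min_def)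
  moreover have "g y = 0"
    using zero P by simp
  ultimately have "g x \<le> 0"
    using f P c by (simp add: not_less mult_le_0_iff)
  then show "x = y"
    using nonneg zero \<open>P x\<close> by (metis antisym)
next
  assume "x = y"
  moreover have "g y = 0"
    using zero P by simp
  ultimately show "is_arg_min f P x"
    using f P c nonneg by (auto simp: is_arg_min_def not_less)
qed

text \<open>The equivalence contains existence and uniqueness of the minimiser. The normalisation is
  forced: if all \<open>Xs i\<close> coincide, the mean must be that matrix, so the weights
  \<open>1 / \<mu> i\<close> are divided by their sum.\<close>

theorem proposition9:
  fixes Xs :: "nat \<Rightarrow> complex^'n^'n" and m :: nat and \<mu> :: "nat \<Rightarrow> real"
  assumes "m \<ge> 1"
    and "\<And>i. i \<in> {1..m} \<Longrightarrow> hpd (Xs i)"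
    and "\<And>i. i \<in> {1..m} \<Longrightarrow> \<mu> i = sqrt (1 + (frobenius_norm (mlog (Xs i)))\<^sup>2)"
  shows "is_tvn_mean m Xs M \<longleftrightarrow>
    M = mexp (inverse (\<Sum>j=1..m. 1 / \<mu> j) *\<^sub>R (\<Sum>i=1..m. mlog (Xs i) /\<^sub>R \<mu> i))"
proof -
  define W where "W = (\<Sum>j=1..m. 1 / \<mu> j)"
  define L where "L = inverse W *\<^sub>R (\<Sum>i=1..m. mlog (Xs i) /\<^sub>R \<mu> i)"
  have \<mu>: "0 < \<mu> i" if "i \<in> {1..m}" for i
    using assms(3)[OF that] by (simp add: add_pos_nonneg)
  have W: "0 < W"
    unfolding W_def using assms(1) \<mu> by (intro sum_pos) auto
  have L: "hermitian L"
    unfolding L_def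
    by (intro hermitian_scaleR hermitian_sum hermitian_mlog assms(2))
  \<comment> \<open>The divergence in Klein's inequality with \<open>mexp L\<close> as second
    argument, \<open>L\<close> standing for its logarithm.\<close>
  define D where "D X = Re (trace (X ** (mlog X - L) - X + mexp L))" for X
  have bilin: "Re (trace (X ** (r *\<^sub>R A))) = r * Re (trace (X ** A))" for r and X A :: "complex^'n^'n"
    by (simp add: trace_def matrix_matrix_mult_def sum_distrib_left algebra_simps)
  have trace_sum: "Re (trace (X ** sum f I)) = (\<Sum>i\<in>I. Re (trace (X ** f i)))"
    for X and f :: "nat \<Rightarrow> complex^'n^'n" and I
    by (induction I rule: infinite_finite_induct) (simp_all add: matrix_add_ldistrib trace_def sum.distrib)
  have "(1 / real m) * (\<Sum>i=1..m. tvn_divergence X (Xs i))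
      = W / real m * D X + ((\<Sum>i=1..m. Re (trace (Xs i)) / \<mu> i) - W * Re (trace (mexp L))) / real m"
    if "hpd X" for X
  proof -
    \<comment> \<open>The choice of \<open>L\<close> makes the terms linear in the logarithms of the
      \<open>Xs i\<close> collapse into a single one.\<close>
    have "W * Re (trace (X ** L)) = Re (trace (X ** (\<Sum>i=1..m. mlog (Xs i) /\<^sub>R \<mu> i)))"
      using W by (simp add: L_def bilin)
    then have XL: "(\<Sum>i=1..m. Re (trace (X ** mlog (Xs i))) / \<mu> i) = W * Re (trace (X ** L))"
      by (simp add: trace_sum bilin divide_inverse_commute)
    \<comment> \<open>Each denominator is \<open>\<mu> i\<close>, independent of \<open>X\<close>,
      so the divergences add up as weighted traces.\<close>
    have "(\<Sum>i=1..m. tvn_divergence X (Xs i))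
        = (\<Sum>i=1..m. (1 / \<mu> i) * (Re (trace (X ** mlog X)) - Re (trace X))
            - Re (trace (X ** mlog (Xs i))) / \<mu> i + Re (trace (Xs i)) / \<mu> i)"
      by (intro sum.cong refl)
        (simp add: tvn_divergence_def assms(3) matrix_diff_distrib_left trace_add trace_sub
          diff_divide_distrib add_divide_distrib)
    also have "\<dots> = W * (Re (trace (X ** mlog X)) - Re (trace X))
        - W * Re (trace (X ** L)) + (\<Sum>i=1..m. Re (trace (Xs i)) / \<mu> i)"
      by (simp only: sum.distrib sum_subtractf XL W_def sum_distrib_right)
    also have "\<dots> = W * D X + ((\<Sum>i=1..m. Re (trace (Xs i)) / \<mu> i) - W * Re (trace (mexp L)))"
      by (simp add: D_def matrix_diff_distrib_left trace_add trace_sub algebra_simps)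
    finally show ?thesis
      by (simp add: add_divide_distrib)
  qed
  then have "is_tvn_mean m Xs M \<longleftrightarrow> M = mexp L"
    unfolding is_tvn_mean_def using W assms(1) klein_inequality[OF _ hpd_mexp[OF L]]
    by (intro is_arg_min_shift[where g = D and c = "W / real m"])
      (auto simp: D_def mlog_mexp L hpd_mexp)
  then show ?thesis
    by (simp add: L_def W_def)
qed

end
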